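(* Let $\mathcal{C}$ be a locally Cartesian closed model category and let $q:E\to B$ be a fibration in $\mathcal{C}$. Suppose that, in the slice category $\mathcal{C}/(B\times B)$, the assignment $Z\mapsto Hom^{(w)}_{B\times B}(Z\times (E\underline{\times}B),B\underline{\times}E)$ is a functor (a subfunctor of $Hom_{B\times B}(-\times (E\underline{\times}B),B\underline{\times}E)$) represented by an object $\big((B\underline{\times}E)^{E\underline{\times}B}\big)_w$. Let $\bar m_q:B_\delta\to (B\underline{\times}E)^{E\underline{\times}B}$ be the obvious morphism from the diagonal to the exponential, and let $\iota:\big((B\underline{\times}E)^{E\underline{\times}B}\big)_w\to (B\underline{\times}E)^{E\underline{\times}B}$ be the morphism induced by the inclusion of functors $Hom^{(w)}_{B\times B}(-\times (E\underline{\times}B),B\underline{\times}E)\subseteq Hom_{B\times B}(-\times (E\underline{\times}B),B\underline{\times}E)$. Then there is a unique morphism $m_q:B_\delta\to \big((B\underline{\times}E)^{E\underline{\times}B}\big)_w$ in $\mathcal{C}/(B\times B)$ such that $\bar m_q=\iota\circ m_q$.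
   Context: Model categories are in the sense of Quillen (finite limits and colimits; classes of fibrations, cofibrations and weak equivalences satisfying the usual lifting, factorization, stability and two-out-of-three axioms; isomorphisms are weak equivalences). The slice $\mathcal{C}/X$ is a model category in which a morphism is a fibration, cofibration or weak equivalence iff its underlying morphism in $\mathcal{C}$ is. Locally Cartesian closed means that every slice $\mathcal{C}/X$ is Cartesian closed. For objects $Z,P,Q$ of $\mathcal{C}/(B\times B)$, with products taken in $\mathcal{C}/(B\times B)$, $$Hom^{(w)}_{B\times B}(Z\times P,Q)=\{h:Z\times P\to Q \mid (\mathrm{pr}_Z,h):Z\times P\to Z\times Q\text{ is a weak equivalence}\}\subseteq Hom_{B\times B}(Z\times P,Q).$$ The following are objects of $\mathcal{C}/(B\times B)$: - $B_\delta$, given by the diagonal $\delta:B\to B\times B$; - $E\underline{\times}B$, given by $(q\circ \mathrm{pr}_E,\mathrm{pr}_B):E\times B\to B\times B$; - $B\underline{\times}E$, given by $\tau\circ(q\circ \mathrm{pr}_E,\mathrm{pr}_B):E\times B\to B\times B$, where $\tau:B\times B\to B\times B$ swaps the factors. The exponential $(B\underline{\times}E)^{E\underline{\times}B}$ is taken in $\mathcal{C}/(B\times B)$. Obvious morphism: the product $B_\delta\times(E\underline{\times}B)$ in $\mathcal{C}/(B\times B)$ is the pullback of $\delta$ and $(q\circ \mathrm{pr}_E,\mathrm{pr}_B)$. Since $\tau\circ\delta=\delta$, its projection to $E\times B$ defines a morphism $h:B_\delta\times(E\underline{\times}B)\to B\underline{\times}E$ in $\mathcal{C}/(B\times B)$.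 Then $\bar m_q$ is the morphism corresponding to $h$ under the adjunction $Hom_{B\times B}(Z\times (E\underline{\times}B),B\underline{\times}E)\cong Hom_{B\times B}(Z,(B\underline{\times}E)^{E\underline{\times}B})$. *)

theory Defs
  imports Main "HOL-Library.FuncSet"
begin

section \<open>Categories\<close>

record ('o, 'a) category =
  Obj :: "'o set"
  Arr :: "'a set"
  Dom :: "'a \<Rightarrow> 'o"
  Cod :: "'a \<Rightarrow> 'o"
  Ide :: "'o \<Rightarrow> 'a"
  Comp :: "'a \<Rightarrow> 'a \<Rightarrow> 'a"  (infixr \<open>\<cdot>\<index>\<close> 75)

definition Hom :: "('o, 'a, 'x) category_scheme \<Rightarrow> 'o \<Rightarrow> 'o \<Rightarrow> 'a set" where
  "Hom C X Y = {f \<in> Arr C. Dom C f = X \<and> Cod C f = Y}"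

locale category =
  fixes C :: "('o, 'a, 'x) category_scheme" (structure)
  assumes Dom_Obj: "f \<in> Arr C \<Longrightarrow> Dom C f \<in> Obj C"
    and Cod_Obj: "f \<in> Arr C \<Longrightarrow> Cod C f \<in> Obj C"
    and Ide_Hom: "X \<in> Obj C \<Longrightarrow> Ide C X \<in> Hom C X X"
    and Comp_Hom: "\<lbrakk>f \<in> Hom C X Y; g \<in> Hom C Y Z\<rbrakk> \<Longrightarrow> g \<cdot> f \<in> Hom C X Z"
    and Comp_Ide: "f \<in> Hom C X Y \<Longrightarrow> f \<cdot> Ide C X = f"
    and Ide_Comp: "f \<in> Hom C X Y \<Longrightarrow> Ide C Y \<cdot> f = f"
    and Comp_assoc: "\<lbrakk>f \<in> Hom C X Y; g \<in> Hom C Y Z; h \<in> Hom C Z U\<rbrakk>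
      \<Longrightarrow> (h \<cdot> g) \<cdot> f = h \<cdot> (g \<cdot> f)"

definition iso :: "('o, 'a, 'x) category_scheme \<Rightarrow> 'a \<Rightarrow> bool" where
  "iso C f \<longleftrightarrow> f \<in> Arr C \<and>
     (\<exists>g \<in> Hom C (Cod C f) (Dom C f).
        g \<cdot>\<^bsub>C\<^esub> f = Ide C (Dom C f) \<and> f \<cdot>\<^bsub>C\<^esub> g = Ide C (Cod C f))"

definition opposite :: "('o, 'a, 'x) category_scheme \<Rightarrow> ('o, 'a) category" where
  "opposite C = \<lparr>Obj = Obj C, Arr = Arr C, Dom = Cod C, Cod = Dom C, Ide = Ide C,
     Comp = (\<lambda>g f. f \<cdot>\<^bsub>C\<^esub> g)\<rparr>"


section \<open>Finite limits and colimits\<close>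

definition is_functor ::
  "('i, 'j, 'x) category_scheme \<Rightarrow> ('o, 'a, 'y) category_scheme
    \<Rightarrow> ('i \<Rightarrow> 'o) \<Rightarrow> ('j \<Rightarrow> 'a) \<Rightarrow> bool" where
  "is_functor J C F0 F1 \<longleftrightarrow>
     (\<forall>i \<in> Obj J. F0 i \<in> Obj C \<and> F1 (Ide J i) = Ide C (F0 i)) \<and>
     (\<forall>u \<in> Arr J. F1 u \<in> Hom C (F0 (Dom J u)) (F0 (Cod J u))) \<and>
     (\<forall>u \<in> Arr J. \<forall>v \<in> Arr J. Cod J u = Dom J v \<longrightarrow> F1 (v \<cdot>\<^bsub>J\<^esub> u) = F1 v \<cdot>\<^bsub>C\<^esub> F1 u)"

definition cone ::
  "('i, 'j, 'x) category_scheme \<Rightarrow> ('o, 'a, 'y) category_scheme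
    \<Rightarrow> ('i \<Rightarrow> 'o) \<Rightarrow> ('j \<Rightarrow> 'a) \<Rightarrow> 'o \<Rightarrow> ('i \<Rightarrow> 'a) \<Rightarrow> bool" where
  "cone J C F0 F1 X c \<longleftrightarrow> X \<in> Obj C \<and>
     (\<forall>i \<in> Obj J. c i \<in> Hom C X (F0 i)) \<and>
     (\<forall>u \<in> Arr J. F1 u \<cdot>\<^bsub>C\<^esub> c (Dom J u) = c (Cod J u))"

definition is_limit ::
  "('i, 'j, 'x) category_scheme \<Rightarrow> ('o, 'a, 'y) category_scheme
    \<Rightarrow> ('i \<Rightarrow> 'o) \<Rightarrow> ('j \<Rightarrow> 'a) \<Rightarrow> 'o \<Rightarrow> ('i \<Rightarrow> 'a) \<Rightarrow> bool" where
  "is_limit J C F0 F1 X c \<longleftrightarrow> cone J C F0 F1 X c \<and>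
     (\<forall>Y d. cone J C F0 F1 Y d \<longrightarrow>
        (\<exists>!u. u \<in> Hom C Y X \<and> (\<forall>i \<in> Obj J. c i \<cdot>\<^bsub>C\<^esub> u = d i)))"

text \<open>Every finite category is isomorphic to one whose objects and arrows are natural
  numbers, so index categories of this type suffice.\<close>

definition has_finite_limits :: "('o, 'a, 'x) category_scheme \<Rightarrow> bool" where
  "has_finite_limits C \<longleftrightarrow>
     (\<forall>(J :: (nat, nat) category) F0 F1.
        category J \<and> finite (Obj J) \<and> finite (Arr J) \<and> is_functor J C F0 F1 \<longrightarrow>
        (\<exists>X c. is_limit J C F0 F1 X c))"

definition has_finite_colimits :: "('o, 'a, 'x) category_scheme \<Rightarrow> bool" where
  "has_finite_colimits C \<longleftrightarrow> has_finite_limits (opposite C)"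

definition is_terminal :: "('o, 'a, 'x) category_scheme \<Rightarrow> 'o \<Rightarrow> bool" where
  "is_terminal C T \<longleftrightarrow> T \<in> Obj C \<and> (\<forall>X \<in> Obj C. \<exists>!u. u \<in> Hom C X T)"

definition is_product ::
  "('o, 'a, 'x) category_scheme \<Rightarrow> 'o \<Rightarrow> 'o \<Rightarrow> 'o \<Rightarrow> 'a \<Rightarrow> 'a \<Rightarrow> bool" where
  "is_product C X Y R p1 p2 \<longleftrightarrow> p1 \<in> Hom C R X \<and> p2 \<in> Hom C R Y \<and>
     (\<forall>Z \<in> Obj C. \<forall>f \<in> Hom C Z X. \<forall>g \<in> Hom C Z Y.
        \<exists>!u. u \<in> Hom C Z R \<and> p1 \<cdot>\<^bsub>C\<^esub> u = f \<and> p2 \<cdot>\<^bsub>C\<^esub> u = g)"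

text \<open>In \<open>is_pullback C f g P f' g'\<close> the arrow \<open>g'\<close> is the base change of \<open>g\<close> along \<open>f\<close>:
  \<open>f \<cdot> g' = g \<cdot> f'\<close>.\<close>

definition is_pullback ::
  "('o, 'a, 'x) category_scheme \<Rightarrow> 'a \<Rightarrow> 'a \<Rightarrow> 'o \<Rightarrow> 'a \<Rightarrow> 'a \<Rightarrow> bool" where
  "is_pullback C f g P f' g' \<longleftrightarrow>
     f \<in> Arr C \<and> g \<in> Arr C \<and> Cod C f = Cod C g \<and>
     g' \<in> Hom C P (Dom C f) \<and> f' \<in> Hom C P (Dom C g) \<and> f \<cdot>\<^bsub>C\<^esub> g' = g \<cdot>\<^bsub>C\<^esub> f' \<and>
     (\<forall>Z \<in> Obj C. \<forall>a \<in> Hom C Z (Dom C f). \<forall>b \<in> Hom C Z (Dom C g).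
        f \<cdot>\<^bsub>C\<^esub> a = g \<cdot>\<^bsub>C\<^esub> b \<longrightarrow>
        (\<exists>!u. u \<in> Hom C Z P \<and> g' \<cdot>\<^bsub>C\<^esub> u = a \<and> f' \<cdot>\<^bsub>C\<^esub> u = b))"

definition is_pushout ::
  "('o, 'a, 'x) category_scheme \<Rightarrow> 'a \<Rightarrow> 'a \<Rightarrow> 'o \<Rightarrow> 'a \<Rightarrow> 'a \<Rightarrow> bool" where
  "is_pushout C f g P f' g' \<longleftrightarrow> is_pullback (opposite C) f g P f' g'"


section \<open>Chosen products and exponentials\<close>

text \<open>Products and exponentials are determined only up to isomorphism; statements
  quantify over arbitrary choices of them.\<close>

record ('o, 'a) products =
  Prod :: "'o \<Rightarrow> 'o \<Rightarrow> 'o"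
  Pr1 :: "'o \<Rightarrow> 'o \<Rightarrow> 'a"
  Pr2 :: "'o \<Rightarrow> 'o \<Rightarrow> 'a"

definition binary_products ::
  "('o, 'a, 'x) category_scheme \<Rightarrow> ('o, 'a) products \<Rightarrow> bool" where
  "binary_products C K \<longleftrightarrow>
     (\<forall>X \<in> Obj C. \<forall>Y \<in> Obj C. is_product C X Y (Prod K X Y) (Pr1 K X Y) (Pr2 K X Y))"

text \<open>The arrow \<open>(f, g)\<close> into the product of the codomains.\<close>

definition pair ::
  "('o, 'a, 'x) category_scheme \<Rightarrow> ('o, 'a) products \<Rightarrow> 'a \<Rightarrow> 'a \<Rightarrow> 'a" where
  "pair C K f g = (THE u. u \<in> Hom C (Dom C f) (Prod K (Cod C f) (Cod C g)) \<and>
     Pr1 K (Cod C f) (Cod C g) \<cdot>\<^bsub>C\<^esub> u = f \<and> Pr2 K (Cod C f) (Cod C g) \<cdot>\<^bsub>C\<^esub> u = g)"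

text \<open>The arrow \<open>u \<times> P\<close>.\<close>

definition prod_right ::
  "('o, 'a, 'x) category_scheme \<Rightarrow> ('o, 'a) products \<Rightarrow> 'a \<Rightarrow> 'o \<Rightarrow> 'a" where
  "prod_right C K u P = pair C K (u \<cdot>\<^bsub>C\<^esub> Pr1 K (Dom C u) P) (Pr2 K (Dom C u) P)"

definition exp_untranspose ::
  "('o, 'a, 'x) category_scheme \<Rightarrow> ('o, 'a) products \<Rightarrow> 'o \<Rightarrow> 'a \<Rightarrow> 'a \<Rightarrow> 'a" where
  "exp_untranspose C K P ev k = ev \<cdot>\<^bsub>C\<^esub> prod_right C K k P"

text \<open>\<open>V\<close> with evaluation \<open>ev : V \<times> P \<rightarrow> Q\<close> is an exponential of \<open>Q\<close> by \<open>P\<close>.\<close>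

definition is_exponential ::
  "('o, 'a, 'x) category_scheme \<Rightarrow> ('o, 'a) products
    \<Rightarrow> 'o \<Rightarrow> 'o \<Rightarrow> 'o \<Rightarrow> 'a \<Rightarrow> bool" where
  "is_exponential C K P Q V ev \<longleftrightarrow> V \<in> Obj C \<and> ev \<in> Hom C (Prod K V P) Q \<and>
     (\<forall>Z \<in> Obj C. \<forall>h \<in> Hom C (Prod K Z P) Q.
        \<exists>!k. k \<in> Hom C Z V \<and> exp_untranspose C K P ev k = h)"

definition exp_transpose ::
  "('o, 'a, 'x) category_scheme \<Rightarrow> ('o, 'a) products
    \<Rightarrow> 'o \<Rightarrow> 'o \<Rightarrow> 'a \<Rightarrow> 'o \<Rightarrow> 'a \<Rightarrow> 'a" where
  "exp_transpose C K P V ev Z h = (THE k. k \<in> Hom C Z V \<and> exp_untranspose C K P ev k = h)"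

definition cartesian_closed :: "('o, 'a, 'x) category_scheme \<Rightarrow> bool" where
  "cartesian_closed C \<longleftrightarrow> (\<exists>T. is_terminal C T) \<and>
     (\<exists>K. binary_products C K \<and>
        (\<forall>P \<in> Obj C. \<forall>Q \<in> Obj C. \<exists>V ev. is_exponential C K P Q V ev))"


section \<open>Slice categories\<close>

text \<open>An object of \<open>C/X\<close> is an arrow of \<open>C\<close> with codomain \<open>X\<close>; an arrow of \<open>C/X\<close> from \<open>f\<close>
  to \<open>g\<close> is a triple \<open>(f, k, g)\<close> with \<open>g \<cdot> k = f\<close>, whose underlying arrow is \<open>k\<close>.\<close>

definition slice ::
  "('o, 'a, 'x) category_scheme \<Rightarrow> 'o \<Rightarrow> ('a, 'a \<times> 'a \<times> 'a) category" where
  "slice C X = \<lparr>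
     Obj = {f \<in> Arr C. Cod C f = X},
     Arr = {(f, k, g). f \<in> Arr C \<and> g \<in> Arr C \<and> Cod C f = X \<and> Cod C g = X \<and>
              k \<in> Hom C (Dom C f) (Dom C g) \<and> g \<cdot>\<^bsub>C\<^esub> k = f},
     Dom = (\<lambda>(f, k, g). f),
     Cod = (\<lambda>(f, k, g). g),
     Ide = (\<lambda>f. (f, Ide C (Dom C f), f)),
     Comp = (\<lambda>(f', k', g') (f, k, g). (f, k' \<cdot>\<^bsub>C\<^esub> k, g'))\<rparr>"

definition underlying :: "'a \<times> 'a \<times> 'a \<Rightarrow> 'a" where
  "underlying t = fst (snd t)"

definition locally_cartesian_closed :: "('o, 'a, 'x) category_scheme \<Rightarrow> bool" where
  "locally_cartesian_closed C \<longleftrightarrow> (\<forall>X \<in> Obj C. cartesian_closed (slice C X))"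


section \<open>Model categories\<close>

record ('o, 'a) model_cat = "('o, 'a) category" +
  Fib :: "'a set"
  Cof :: "'a set"
  Weq :: "'a set"

text \<open>Quillen's (not necessarily closed) model categories.\<close>

locale model_category = category C
  for C :: "('o, 'a, 'x) model_cat_scheme" (structure) +
  assumes Fib_Arr: "Fib C \<subseteq> Arr C"
    and Cof_Arr: "Cof C \<subseteq> Arr C"
    and Weq_Arr: "Weq C \<subseteq> Arr C"
    and finite_limits: "has_finite_limits C"
    and finite_colimits: "has_finite_colimits C"
    and lifting:
      "\<lbrakk>i \<in> Cof C; p \<in> Fib C; i \<in> Weq C \<or> p \<in> Weq C;
        a \<in> Hom C (Dom C i) (Dom C p); b \<in> Hom C (Cod C i) (Cod C p); p \<cdot> a = b \<cdot> i\<rbrakk>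
       \<Longrightarrow> \<exists>l \<in> Hom C (Cod C i) (Dom C p). l \<cdot> i = a \<and> p \<cdot> l = b"
    and factorization_Fib:
      "f \<in> Arr C \<Longrightarrow> \<exists>i p. i \<in> Cof C \<and> i \<in> Weq C \<and> p \<in> Fib C \<and>
         Dom C p = Cod C i \<and> f = p \<cdot> i"
    and factorization_Cof:
      "f \<in> Arr C \<Longrightarrow> \<exists>i p. i \<in> Cof C \<and> p \<in> Fib C \<and> p \<in> Weq C \<and>
         Dom C p = Cod C i \<and> f = p \<cdot> i"
    and Fib_Comp: "\<lbrakk>f \<in> Fib C; g \<in> Fib C; Cod C f = Dom C g\<rbrakk> \<Longrightarrow> g \<cdot> f \<in> Fib C"
    and Fib_base_change: "\<lbrakk>g \<in> Fib C; is_pullback C f g P f' g'\<rbrakk> \<Longrightarrow> g' \<in> Fib C"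
    and Fib_iso: "iso C f \<Longrightarrow> f \<in> Fib C"
    and Cof_Comp: "\<lbrakk>f \<in> Cof C; g \<in> Cof C; Cod C f = Dom C g\<rbrakk> \<Longrightarrow> g \<cdot> f \<in> Cof C"
    and Cof_cobase_change: "\<lbrakk>g \<in> Cof C; is_pushout C f g P f' g'\<rbrakk> \<Longrightarrow> g' \<in> Cof C"
    and Cof_iso: "iso C f \<Longrightarrow> f \<in> Cof C"
    and Weq_base_change:
      "\<lbrakk>g \<in> Fib C; g \<in> Weq C; is_pullback C f g P f' g'\<rbrakk> \<Longrightarrow> g' \<in> Weq C"
    and Weq_cobase_change:
      "\<lbrakk>g \<in> Cof C; g \<in> Weq C; is_pushout C f g P f' g'\<rbrakk> \<Longrightarrow> g' \<in> Weq C"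
    and two_out_of_three_Comp:
      "\<lbrakk>f \<in> Arr C; g \<in> Arr C; Cod C f = Dom C g; f \<in> Weq C; g \<in> Weq C\<rbrakk>
       \<Longrightarrow> g \<cdot> f \<in> Weq C"
    and two_out_of_three_left:
      "\<lbrakk>f \<in> Arr C; g \<in> Arr C; Cod C f = Dom C g; f \<in> Weq C; g \<cdot> f \<in> Weq C\<rbrakk>
       \<Longrightarrow> g \<in> Weq C"
    and two_out_of_three_right:
      "\<lbrakk>f \<in> Arr C; g \<in> Arr C; Cod C f = Dom C g; g \<in> Weq C; g \<cdot> f \<in> Weq C\<rbrakk>
       \<Longrightarrow> f \<in> Weq C"
    and Weq_iso: "iso C f \<Longrightarrow> f \<in> Weq C"

definition slice_model ::
  "('o, 'a, 'x) model_cat_scheme \<Rightarrow> 'o \<Rightarrow> ('a, 'a \<times> 'a \<times> 'a) model_cat" where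
  "slice_model C X = category.extend (slice C X) (model_cat.fields
     {t \<in> Arr (slice C X). underlying t \<in> Fib C}
     {t \<in> Arr (slice C X). underlying t \<in> Cof C}
     {t \<in> Arr (slice C X). underlying t \<in> Weq C})"


section \<open>Set-valued contravariant functors\<close>

record ('o, 'a, 's) presheaf =
  Sec :: "'o \<Rightarrow> 's set"
  Res :: "'a \<Rightarrow> 's \<Rightarrow> 's"

definition is_presheaf ::
  "('o, 'a, 'x) category_scheme \<Rightarrow> ('o, 'a, 's) presheaf \<Rightarrow> bool" where
  "is_presheaf C F \<longleftrightarrow>
     (\<forall>u \<in> Arr C. Res F u \<in> Sec F (Cod C u) \<rightarrow> Sec F (Dom C u)) \<and>
     (\<forall>X \<in> Obj C. \<forall>x \<in> Sec F X. Res F (Ide C X) x = x) \<and>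
     (\<forall>u \<in> Arr C. \<forall>v \<in> Arr C. Cod C u = Dom C v \<longrightarrow>
        (\<forall>x \<in> Sec F (Cod C v). Res F (v \<cdot>\<^bsub>C\<^esub> u) x = Res F u (Res F v x)))"

definition is_subfunctor ::
  "('o, 'a, 'x) category_scheme \<Rightarrow> ('o, 'a, 's) presheaf
    \<Rightarrow> ('o, 'a, 's) presheaf \<Rightarrow> bool" where
  "is_subfunctor C F G \<longleftrightarrow> is_presheaf C F \<and> is_presheaf C G \<and>
     (\<forall>X \<in> Obj C. Sec F X \<subseteq> Sec G X) \<and>
     (\<forall>u \<in> Arr C. \<forall>x \<in> Sec F (Cod C u). Res F u x = Res G u x)"

definition yoneda :: "('o, 'a, 'x) category_scheme \<Rightarrow> 'o \<Rightarrow> ('o, 'a, 'a) presheaf" where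
  "yoneda C W = \<lparr>Sec = (\<lambda>Z. Hom C Z W), Res = (\<lambda>u f. f \<cdot>\<^bsub>C\<^esub> u)\<rparr>"

definition natural_iso ::
  "('o, 'a, 'x) category_scheme \<Rightarrow> ('o, 'a, 's) presheaf \<Rightarrow> ('o, 'a, 't) presheaf
    \<Rightarrow> ('o \<Rightarrow> 's \<Rightarrow> 't) \<Rightarrow> bool" where
  "natural_iso C F G \<phi> \<longleftrightarrow>
     (\<forall>X \<in> Obj C. bij_betw (\<phi> X) (Sec F X) (Sec G X)) \<and>
     (\<forall>u \<in> Arr C. \<forall>x \<in> Sec F (Cod C u). \<phi> (Dom C u) (Res F u x) = Res G u (\<phi> (Cod C u) x))"

definition represents ::
  "('o, 'a, 'x) category_scheme \<Rightarrow> ('o, 'a, 's) presheaf \<Rightarrow> 'o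
    \<Rightarrow> ('o \<Rightarrow> 'a \<Rightarrow> 's) \<Rightarrow> bool" where
  "represents C F W \<phi> \<longleftrightarrow> W \<in> Obj C \<and> is_presheaf C F \<and> natural_iso C (yoneda C W) F \<phi>"

text \<open>If \<open>\<phi>\<close> and \<open>\<psi>\<close> represent \<open>F\<close> and \<open>G\<close> by \<open>W\<close> and \<open>V\<close>, and \<open>F\<close> is a subfunctor of \<open>G\<close>,
  this is the arrow \<open>W \<rightarrow> V\<close> that corresponds to the inclusion by Yoneda.\<close>

definition induced_by_inclusion ::
  "('o, 'a, 'x) category_scheme \<Rightarrow> 'o \<Rightarrow> ('o \<Rightarrow> 'a \<Rightarrow> 's) \<Rightarrow> 'o \<Rightarrow> ('o \<Rightarrow> 'a \<Rightarrow> 's) \<Rightarrow> 'a"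
where
  "induced_by_inclusion C W \<phi> V \<psi> =
     (THE i. i \<in> Hom C W V \<and>
        (\<forall>Z \<in> Obj C. \<forall>u \<in> Hom C Z W. \<psi> Z (i \<cdot>\<^bsub>C\<^esub> u) = \<phi> Z u))"

text \<open>\<open>Z \<mapsto> Hom(Z \<times> P, Q)\<close> and its weak-equivalence version.\<close>

definition Hom_prod ::
  "('o, 'a, 'x) category_scheme \<Rightarrow> ('o, 'a) products \<Rightarrow> 'o \<Rightarrow> 'o \<Rightarrow> ('o, 'a, 'a) presheaf"
where
  "Hom_prod C K P Q = \<lparr>Sec = (\<lambda>Z. Hom C (Prod K Z P) Q),
     Res = (\<lambda>u h. h \<cdot>\<^bsub>C\<^esub> prod_right C K u P)\<rparr>"

definition Hom_prod_weq ::
  "('o, 'a, 'x) model_cat_scheme \<Rightarrow> ('o, 'a) products \<Rightarrow> 'o \<Rightarrow> 'o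
    \<Rightarrow> ('o, 'a, 'a) presheaf" where
  "Hom_prod_weq C K P Q =
     \<lparr>Sec = (\<lambda>Z. {h \<in> Hom C (Prod K Z P) Q. pair C K (Pr1 K Z P) h \<in> Weq C}),
      Res = (\<lambda>u h. h \<cdot>\<^bsub>C\<^esub> prod_right C K u P)\<rparr>"


section \<open>The objects over \<open>B \<times> B\<close> attached to \<open>q : E \<rightarrow> B\<close>\<close>

definition diag :: "('o, 'a, 'x) category_scheme \<Rightarrow> ('o, 'a) products \<Rightarrow> 'o \<Rightarrow> 'a" where
  "diag C K B = pair C K (Ide C B) (Ide C B)"

definition swap :: "('o, 'a, 'x) category_scheme \<Rightarrow> ('o, 'a) products \<Rightarrow> 'o \<Rightarrow> 'a" where
  "swap C K B = pair C K (Pr2 K B B) (Pr1 K B B)"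

definition E_times_B ::
  "('o, 'a, 'x) category_scheme \<Rightarrow> ('o, 'a) products \<Rightarrow> 'o \<Rightarrow> 'o \<Rightarrow> 'a \<Rightarrow> 'a" where
  "E_times_B C K E B q = pair C K (q \<cdot>\<^bsub>C\<^esub> Pr1 K E B) (Pr2 K E B)"

definition B_times_E ::
  "('o, 'a, 'x) category_scheme \<Rightarrow> ('o, 'a) products \<Rightarrow> 'o \<Rightarrow> 'o \<Rightarrow> 'a \<Rightarrow> 'a" where
  "B_times_E C K E B q = swap C K B \<cdot>\<^bsub>C\<^esub> E_times_B C K E B q"

text \<open>With \<open>L\<close> a choice of products in the slice over \<open>B \<times> B\<close>: the arrow from
  \<open>B\<^sub>\<delta> \<times> (E \<times> B)\<close> to \<open>B \<times> E\<close> whose underlying arrow is that of the second projection.\<close>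

definition diag_proj ::
  "('o, 'a, 'x) category_scheme \<Rightarrow> ('o, 'a) products \<Rightarrow> ('a, 'a \<times> 'a \<times> 'a) products
    \<Rightarrow> 'o \<Rightarrow> 'o \<Rightarrow> 'a \<Rightarrow> 'a \<times> 'a \<times> 'a" where
  "diag_proj C K L E B q =
     (Prod L (diag C K B) (E_times_B C K E B q),
      underlying (Pr2 L (diag C K B) (E_times_B C K E B q)),
      B_times_E C K E B q)"

end

theory Submission
  imports Defs
begin

text \<open>Because \<open>\<tau> \<circ> \<delta> = \<delta>\<close> and \<open>\<tau>\<close> is an involution, pulling back
  \<open>E \<times> B\<close> or \<open>B \<times> E\<close> along the diagonal imposes the same equation. Hence the morphism
  \<open>(pr, h) : B\<^sub>\<delta> \<times> (E \<times> B) \<rightarrow> B\<^sub>\<delta> \<times> (B \<times> E)\<close> is an isomorphism, in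
  particular a weak equivalence, and \<open>h\<close> is a section of the represented subfunctor over
  \<open>B\<^sub>\<delta>\<close>. By Yoneda, \<open>\<iota>\<close> turns the morphism classifying \<open>h\<close> into its exponential transpose.\<close>

section \<open>Products, products of arrows with an object, and exponentials\<close>

lemma Hom_D:
  assumes "f \<in> Hom C X Y"
  shows "f \<in> Arr C" "Dom C f = X" "Cod C f = Y"
  using assms by (auto simp: Hom_def)

context category
begin

lemma Hom_Obj:
  assumes "f \<in> Hom C X Y"
  shows "X \<in> Obj C" "Y \<in> Obj C"
  using assms Dom_Obj Cod_Obj by (auto simp: Hom_def)

lemma binary_products_ex1:
  assumes "binary_products C K" "f \<in> Hom C Z X" "g \<in> Hom C Z Y"
  shows "\<exists>!u. u \<in> Hom C Z (Prod K X Y) \<and> Pr1 K X Y \<cdot> u = f \<and> Pr2 K X Y \<cdot> u = g"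
  using assms Hom_Obj[OF assms(2)] Hom_Obj[OF assms(3)]
  unfolding binary_products_def is_product_def by blast

lemma Pr_Hom:
  assumes "binary_products C K" "X \<in> Obj C" "Y \<in> Obj C"
  shows "Pr1 K X Y \<in> Hom C (Prod K X Y) X" "Pr2 K X Y \<in> Hom C (Prod K X Y) Y"
  using assms unfolding binary_products_def is_product_def by auto

lemma pair_Hom:
  assumes "binary_products C K" "f \<in> Hom C Z X" "g \<in> Hom C Z Y"
  shows "pair C K f g \<in> Hom C Z (Prod K X Y)"
    and Pr1_pair: "Pr1 K X Y \<cdot> pair C K f g = f"
    and Pr2_pair: "Pr2 K X Y \<cdot> pair C K f g = g"
  using theI'[OF binary_products_ex1[OF assms]] Hom_D[OF assms(2)] Hom_D[OF assms(3)]
  by (simp_all add: pair_def)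

lemma product_ext:
  assumes "binary_products C K" "X \<in> Obj C" "Y \<in> Obj C"
    and u: "u \<in> Hom C Z (Prod K X Y)" and v: "v \<in> Hom C Z (Prod K X Y)"
    and "Pr1 K X Y \<cdot> u = Pr1 K X Y \<cdot> v" "Pr2 K X Y \<cdot> u = Pr2 K X Y \<cdot> v"
  shows "u = v"
  using binary_products_ex1[OF assms(1) Comp_Hom[OF v Pr_Hom(1)[OF assms(1-3)]]
      Comp_Hom[OF v Pr_Hom(2)[OF assms(1-3)]]] assms(4-) by blast

lemma prod_right_Hom:
  assumes "binary_products C K" "u \<in> Hom C X Y" "P \<in> Obj C"
  shows "prod_right C K u P \<in> Hom C (Prod K X P) (Prod K Y P)"
    and Pr1_prod_right: "Pr1 K Y P \<cdot> prod_right C K u P = u \<cdot> Pr1 K X P"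
    and Pr2_prod_right: "Pr2 K Y P \<cdot> prod_right C K u P = Pr2 K X P"
proof -
  note X = Hom_Obj(1)[OF assms(2)]
  note pr = Pr_Hom[OF assms(1) X assms(3)]
  note c = Comp_Hom[OF pr(1) assms(2)]
  show "prod_right C K u P \<in> Hom C (Prod K X P) (Prod K Y P)"
    "Pr1 K Y P \<cdot> prod_right C K u P = u \<cdot> Pr1 K X P"
    "Pr2 K Y P \<cdot> prod_right C K u P = Pr2 K X P"
    using pair_Hom[OF assms(1) c pr(2)] Hom_D[OF assms(2)] by (simp_all add: prod_right_def)
qed

lemma prod_right_Comp:
  assumes K: "binary_products C K" and u: "u \<in> Hom C X Y" and v: "v \<in> Hom C Y Z"
    and P: "P \<in> Obj C"
  shows "prod_right C K (v \<cdot> u) P = prod_right C K v P \<cdot> prod_right C K u P"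
proof (rule product_ext[OF K Hom_Obj(2)[OF v] P])
  note vu = Comp_Hom[OF u v]
  note pu = prod_right_Hom[OF K u P] and pv = prod_right_Hom[OF K v P]
    and pvu = prod_right_Hom[OF K vu P]
  note prX = Pr_Hom[OF K Hom_Obj(1)[OF u] P] and prY = Pr_Hom[OF K Hom_Obj(1)[OF v] P]
    and prZ = Pr_Hom[OF K Hom_Obj(2)[OF v] P]
  show "prod_right C K (v \<cdot> u) P \<in> Hom C (Prod K X P) (Prod K Z P)" by (rule pvu(1))
  show "prod_right C K v P \<cdot> prod_right C K u P \<in> Hom C (Prod K X P) (Prod K Z P)"
    by (rule Comp_Hom[OF pu(1) pv(1)])
  show "Pr1 K Z P \<cdot> prod_right C K (v \<cdot> u) P
      = Pr1 K Z P \<cdot> (prod_right C K v P \<cdot> prod_right C K u P)"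
    using Comp_assoc[OF pu(1) pv(1) prZ(1)] Comp_assoc[OF pu(1) prY(1) v]
      Comp_assoc[OF prX(1) u v] pu(2) pv(2) pvu(2) by simp
  show "Pr2 K Z P \<cdot> prod_right C K (v \<cdot> u) P
      = Pr2 K Z P \<cdot> (prod_right C K v P \<cdot> prod_right C K u P)"
    using Comp_assoc[OF pu(1) pv(1) prZ(2)] pu(3) pv(3) pvu(3) by simp
qed

text \<open>Naturality in the source: with the universal property of \<open>ev\<close>, it says that
  \<open>V\<close> represents \<open>Hom_prod C K P Q\<close>. It reduces to functoriality of the
  product with \<open>P\<close>.\<close>

lemma exp_untranspose_Comp:
  assumes K: "binary_products C K" and V: "is_exponential C K P Q V ev" and P: "P \<in> Obj C"
    and u: "u \<in> Hom C X Y" and v: "v \<in> Hom C Y V"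
  shows "exp_untranspose C K P ev (v \<cdot> u)
    = exp_untranspose C K P ev v \<cdot> prod_right C K u P"
proof -
  have ev: "ev \<in> Hom C (Prod K V P) Q"
    using V by (simp add: is_exponential_def)
  show ?thesis
    using Comp_assoc[OF prod_right_Hom(1)[OF K u P] prod_right_Hom(1)[OF K v P] ev]
    by (simp add: exp_untranspose_def prod_right_Comp[OF K u v P])
qed

section \<open>Representability and the Yoneda argument\<close>

text \<open>Justifies the definite description behind \<open>induced_by_inclusion\<close>: by
  Yoneda, the arrow it asks for is exactly the transpose of the universal element of
  \<open>F\<close>.\<close>

lemma induced_by_inclusion_Hom_prod:
  assumes K: "binary_products C K" and P: "P \<in> Obj C"
    and V: "is_exponential C K P Q V ev"
    and sub: "is_subfunctor C F (Hom_prod C K P Q)"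
    and rep: "represents C F W \<phi>"
    and \<iota>: "\<iota> = induced_by_inclusion C W \<phi> V (\<lambda>Z. exp_untranspose C K P ev)"
  shows "\<iota> \<in> Hom C W V"
    and exp_untranspose_induced_by_inclusion:
      "u \<in> Hom C Z W \<Longrightarrow> exp_untranspose C K P ev (\<iota> \<cdot> u) = \<phi> Z u"
proof -
  have W: "W \<in> Obj C" using rep by (simp add: represents_def)
  \<comment> \<open>The universal element, image of the identity of \<open>W\<close>; the subfunctor
    inclusion turns it into an arrow that can be transposed.\<close>
  have "\<phi> W (Ide C W) \<in> Sec F W"
    using rep Ide_Hom[OF W] W
    by (auto simp: represents_def natural_iso_def yoneda_def dest: bij_betwE)
  then have "\<phi> W (Ide C W) \<in> Hom C (Prod K W P) Q"
    using sub W by (auto simp: is_subfunctor_def Hom_prod_def)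
  then have ex1: "\<exists>!k. k \<in> Hom C W V \<and> exp_untranspose C K P ev k = \<phi> W (Ide C W)"
    using V W by (simp add: is_exponential_def)
  \<comment> \<open>Naturality of \<open>\<phi>\<close> at the identity of \<open>W\<close> makes
    every \<open>\<phi> Z u\<close> a restriction of the universal element, and on sections of
    \<open>F\<close> restriction is that of \<open>Hom_prod\<close>.\<close>
  have nat: "\<phi> Z u = \<phi> W (Ide C W) \<cdot> prod_right C K u P" if u: "u \<in> Hom C Z W" for Z u
  proof -
    have "\<phi> Z u = \<phi> Z (Ide C W \<cdot> u)" using Ide_Comp[OF u] by simp
    also have "\<dots> = Res F u (\<phi> W (Ide C W))"
      using rep Ide_Hom[OF W] Hom_D[OF u]
      unfolding represents_def natural_iso_def yoneda_def by auto
    also have "\<dots> = Res (Hom_prod C K P Q) u (\<phi> W (Ide C W))"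
      using sub \<open>\<phi> W (Ide C W) \<in> Sec F W\<close> Hom_D[OF u] by (auto simp: is_subfunctor_def)
    finally show ?thesis by (simp add: Hom_prod_def)
  qed
  let ?I = "\<lambda>i. i \<in> Hom C W V \<and>
    (\<forall>Z \<in> Obj C. \<forall>u \<in> Hom C Z W. exp_untranspose C K P ev (i \<cdot> u) = \<phi> Z u)"
  have "\<exists>!i. ?I i"
  proof -
    obtain k where k: "k \<in> Hom C W V" "exp_untranspose C K P ev k = \<phi> W (Ide C W)"
      using ex1 by blast
    have "?I k"
      using k nat exp_untranspose_Comp[OF K V P _ k(1)] by simp
    moreover have "i = k" if "?I i" for i
    proof -
      \<comment> \<open>Testing the property of \<open>i\<close> on the identity of \<open>W\<close>
        recovers the universal element, whose transpose is unique.\<close>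
      have "exp_untranspose C K P ev i = \<phi> W (Ide C W)"
        using that Ide_Hom[OF W] W Comp_Ide[of i W V] by fastforce
      then show ?thesis using ex1 k that by blast
    qed
    ultimately show ?thesis by blast
  qed
  then have I: "?I \<iota>" unfolding \<iota> induced_by_inclusion_def by (rule theI')
  show "\<iota> \<in> Hom C W V" using I by blast
  show "exp_untranspose C K P ev (\<iota> \<cdot> u) = \<phi> Z u" if "u \<in> Hom C Z W"
    using I that Hom_Obj(1)[OF that] by blast
qed

text \<open>A factorization of the transpose of \<open>h\<close> through \<open>\<iota>\<close> is
  the same as a preimage of \<open>h\<close> under the bijection \<open>\<phi> D\<close>, so
  membership of \<open>h\<close> in the subfunctor is all that has to be checked.\<close>

lemma exp_transpose_factors_uniquely:
  assumes K: "binary_products C K" and P: "P \<in> Obj C"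
    and V: "is_exponential C K P Q V ev"
    and sub: "is_subfunctor C F (Hom_prod C K P Q)"
    and rep: "represents C F W \<phi>"
    and D: "D \<in> Obj C" and h: "h \<in> Sec F D"
    and \<iota>: "\<iota> = induced_by_inclusion C W \<phi> V (\<lambda>Z. exp_untranspose C K P ev)"
  shows "\<exists>!m. m \<in> Hom C D W \<and> exp_transpose C K P V ev D h = \<iota> \<cdot> m"
proof -
  note \<iota>_Hom = induced_by_inclusion_Hom_prod[OF K P V sub rep \<iota>]
  have "h \<in> Hom C (Prod K D P) Q"
    using sub D h by (auto simp: is_subfunctor_def Hom_prod_def)
  then have ex1: "\<exists>!k. k \<in> Hom C D V \<and> exp_untranspose C K P ev k = h"
    using V D by (simp add: is_exponential_def)
  have bij: "bij_betw (\<phi> D) (Hom C D W) (Sec F D)"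
    using rep D by (simp add: represents_def natural_iso_def yoneda_def)
  \<comment> \<open>Both sides are arrows into \<open>V\<close>, hence equal iff they untranspose
    alike; they untranspose to \<open>h\<close> and to \<open>\<phi> D m\<close>.\<close>
  have tr: "exp_transpose C K P V ev D h = \<iota> \<cdot> m \<longleftrightarrow> \<phi> D m = h"
    if m: "m \<in> Hom C D W" for m
    using theI'[OF ex1] ex1 Comp_Hom[OF m \<iota>_Hom(1)] \<iota>_Hom(2)[OF m]
    unfolding exp_transpose_def by metis
  obtain m where "m \<in> Hom C D W" "\<phi> D m = h"
    using bij h unfolding bij_betw_def by (metis imageE)
  moreover have "inj_on (\<phi> D) (Hom C D W)"
    using bij by (simp add: bij_betw_def)
  ultimately show ?thesis using tr by (metis inj_onD)
qed

section \<open>The swap and the diagonal\<close>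

lemma swap_Hom:
  assumes K: "binary_products C K" and B: "B \<in> Obj C"
  shows "swap C K B \<in> Hom C (Prod K B B) (Prod K B B)"
    and swap_swap: "swap C K B \<cdot> swap C K B = Ide C (Prod K B B)"
    and swap_diag: "swap C K B \<cdot> diag C K B = diag C K B"
    and diag_Hom: "diag C K B \<in> Hom C B (Prod K B B)"
proof -
  note pr = Pr_Hom[OF K B B]
  note s = pair_Hom[OF K pr(2) pr(1), folded swap_def]
  note d = pair_Hom[OF K Ide_Hom[OF B] Ide_Hom[OF B], folded diag_def]
  note Id = Ide_Hom[OF Hom_Obj(1)[OF pr(1)]]
  show "swap C K B \<in> Hom C (Prod K B B) (Prod K B B)" by (rule s(1))
  show "diag C K B \<in> Hom C B (Prod K B B)" by (rule d(1))
  show "swap C K B \<cdot> swap C K B = Ide C (Prod K B B)"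
    by (rule product_ext[OF K B B Comp_Hom[OF s(1) s(1)] Id])
      (simp_all add: Comp_assoc[OF s(1) s(1) pr(1), symmetric]
        Comp_assoc[OF s(1) s(1) pr(2), symmetric] s Comp_Ide[OF pr(1)] Comp_Ide[OF pr(2)])
  show "swap C K B \<cdot> diag C K B = diag C K B"
    by (rule product_ext[OF K B B Comp_Hom[OF d(1) s(1)] d(1)])
      (simp_all add: Comp_assoc[OF d(1) s(1) pr(1), symmetric]
        Comp_assoc[OF d(1) s(1) pr(2), symmetric] s d)
qed

end

section \<open>Morphisms and weak equivalences in a slice\<close>

lemma Obj_slice_model: "f \<in> Obj (slice_model C X) \<longleftrightarrow> f \<in> Arr C \<and> Cod C f = X"
  by (simp add: slice_model_def slice_def category.defs)

lemma Hom_slice_model: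
  "t \<in> Hom (slice_model C X) f g \<longleftrightarrow>
    f \<in> Obj (slice_model C X) \<and> g \<in> Obj (slice_model C X) \<and>
    (\<exists>k \<in> Hom C (Dom C f) (Dom C g). t = (f, k, g) \<and> g \<cdot>\<^bsub>C\<^esub> k = f)"
  by (auto simp: Hom_def slice_model_def slice_def category.defs)

lemma slice_model_simps:
  "Ide (slice_model C X) f = (f, Ide C (Dom C f), f)"
  "(f', k', g') \<cdot>\<^bsub>slice_model C X\<^esub> (f, k, g) = (f, k' \<cdot>\<^bsub>C\<^esub> k, g')"
  by (simp_all add: slice_model_def slice_def category.defs)

lemma Weq_slice_model:
  "t \<in> Weq (slice_model C X) \<longleftrightarrow> t \<in> Arr (slice_model C X) \<and> underlying t \<in> Weq C"
  by (simp add: slice_model_def category.defs model_cat.defs)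

text \<open>Makes the product and Yoneda lemmas above available over \<open>X\<close>. The laws are
  inherited from underlying arrows, and the triangle of a composite commutes by
  associativity.\<close>

lemma slice_model_category:
  assumes "category C"
  shows "category (slice_model C X)"
proof -
  interpret category C by fact
  show ?thesis
  proof
    fix t assume "t \<in> Arr (slice_model C X)"
    then have "t \<in> Hom (slice_model C X) (Dom (slice_model C X) t) (Cod (slice_model C X) t)"
      by (simp add: Hom_def)
    then show "Dom (slice_model C X) t \<in> Obj (slice_model C X)"
      "Cod (slice_model C X) t \<in> Obj (slice_model C X)"
      unfolding Hom_slice_model by blast+
  next
    fix f assume f: "f \<in> Obj (slice_model C X)"
    then have "f \<in> Hom C (Dom C f) X" by (simp add: Obj_slice_model Hom_def)
    then show "Ide (slice_model C X) f \<in> Hom (slice_model C X) f f"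
      using f by (simp add: Hom_slice_model slice_model_simps Comp_Ide Ide_Hom Hom_Obj)
  next
    fix s t f g h
    assume "s \<in> Hom (slice_model C X) f g" "t \<in> Hom (slice_model C X) g h"
    then obtain k l where *: "f \<in> Obj (slice_model C X)" "h \<in> Obj (slice_model C X)"
      "k \<in> Hom C (Dom C f) (Dom C g)" "l \<in> Hom C (Dom C g) (Dom C h)"
      "s = (f, k, g)" "t = (g, l, h)" "g \<cdot>\<^bsub>C\<^esub> k = f" "h \<cdot>\<^bsub>C\<^esub> l = g"
      unfolding Hom_slice_model by blast
    then have "h \<in> Hom C (Dom C h) X" by (simp add: Obj_slice_model Hom_def)
    from Comp_assoc[OF *(3,4) this] Comp_Hom[OF *(3,4)] *
    show "t \<cdot>\<^bsub>slice_model C X\<^esub> s \<in> Hom (slice_model C X) f h"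
      by (simp add: Hom_slice_model slice_model_simps)
  next
    fix s f g assume "s \<in> Hom (slice_model C X) f g"
    then show "s \<cdot>\<^bsub>slice_model C X\<^esub> Ide (slice_model C X) f = s"
      "Ide (slice_model C X) g \<cdot>\<^bsub>slice_model C X\<^esub> s = s"
      by (auto simp: Hom_slice_model slice_model_simps Comp_Ide Ide_Comp)
  next
    fix s t r f g h i
    assume "s \<in> Hom (slice_model C X) f g" "t \<in> Hom (slice_model C X) g h"
      "r \<in> Hom (slice_model C X) h i"
    then show "(r \<cdot>\<^bsub>slice_model C X\<^esub> t) \<cdot>\<^bsub>slice_model C X\<^esub> s
        = r \<cdot>\<^bsub>slice_model C X\<^esub> t \<cdot>\<^bsub>slice_model C X\<^esub> s"
      by (auto simp: Hom_slice_model slice_model_simps Comp_assoc)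
  qed
qed

text \<open>The underlying arrow of an isomorphism over \<open>X\<close> is an isomorphism of
  \<open>C\<close>, so \<open>Weq_iso\<close> in \<open>C\<close> suffices and the model axioms of
  the slice are never invoked.\<close>

lemma (in model_category) iso_slice_model_Weq:
  assumes s: "s \<in> Hom (slice_model C X) f g" and t: "t \<in> Hom (slice_model C X) g f"
    and "t \<cdot>\<^bsub>slice_model C X\<^esub> s = Ide (slice_model C X) f"
    and "s \<cdot>\<^bsub>slice_model C X\<^esub> t = Ide (slice_model C X) g"
  shows "s \<in> Weq (slice_model C X)"
proof -
  obtain k where k: "k \<in> Hom C (Dom C f) (Dom C g)" "s = (f, k, g)"
    using s unfolding Hom_slice_model by blast
  obtain l where l: "l \<in> Hom C (Dom C g) (Dom C f)" "t = (g, l, f)"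
    using t unfolding Hom_slice_model by blast
  have "l \<cdot> k = Ide C (Dom C f)" "k \<cdot> l = Ide C (Dom C g)"
    using assms(3,4) k l by (auto simp: slice_model_simps)
  then have "iso C k"
    unfolding iso_def using Hom_D[OF k(1)] l(1) by auto
  then show ?thesis
    using Weq_iso k(2) Hom_D(1)[OF s] by (simp add: Weq_slice_model underlying_def)
qed

section \<open>Reindexing a product along an involution of the base\<close>

context model_category
begin

text \<open>The arrow \<open>r\<close> makes the structure arrow \<open>R\<close> factor through
  \<open>D\<close>, so \<open>\<tau> \<cdot> R = R\<close>. Composing the triangle of
  \<open>s\<close> with \<open>\<tau>\<close> therefore leaves its source over \<open>X\<close>
  unchanged.\<close>

lemma reindex_over_involution:
  assumes \<tau>: "\<tau> \<in> Hom C X X" and \<tau>D: "\<tau> \<cdot> D = D" and D: "D \<in> Obj (slice_model C X)"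
    and P: "P \<in> Obj (slice_model C X)"
    and r: "r \<in> Hom (slice_model C X) R D" and s: "s \<in> Hom (slice_model C X) R P"
  shows "(R, underlying s, \<tau> \<cdot> P) \<in> Hom (slice_model C X) R (\<tau> \<cdot> P)"
proof -
  obtain k where k: "k \<in> Hom C (Dom C R) (Dom C D)" "D \<cdot> k = R"
    and R: "R \<in> Obj (slice_model C X)"
    using r unfolding Hom_slice_model by blast
  obtain l where l: "l \<in> Hom C (Dom C R) (Dom C P)" "P \<cdot> l = R" "s = (R, l, P)"
    using s unfolding Hom_slice_model by blast
  have D': "D \<in> Hom C (Dom C D) X" and P': "P \<in> Hom C (Dom C P) X"
    using D P by (simp_all add: Obj_slice_model Hom_def)
  note \<tau>P = Hom_D[OF Comp_Hom[OF P' \<tau>]]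
  have "(\<tau> \<cdot> P) \<cdot> l = R"
    using Comp_assoc[OF l(1) P' \<tau>] Comp_assoc[OF k(1) D' \<tau>] k(2) l(2) \<tau>D by simp
  then show ?thesis
    using l R \<tau>P by (auto simp: Hom_slice_model Obj_slice_model underlying_def)
qed

text \<open>The construction is symmetric: since \<open>\<tau>\<close> is an involution, applying it
  to \<open>\<tau> \<cdot> P\<close> leads back to \<open>P\<close> and gives an inverse over
  \<open>D\<close>.\<close>

lemma diag_reindex_Weq:
  assumes \<tau>: "\<tau> \<in> Hom C X X" "\<tau> \<cdot> \<tau> = Ide C X" "\<tau> \<cdot> D = D"
    and D: "D \<in> Obj (slice_model C X)" and P: "P \<in> Obj (slice_model C X)"
    and L: "binary_products (slice_model C X) L"
    and h: "h = (Prod L D P, underlying (Pr2 L D P), \<tau> \<cdot> P)"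
  shows "h \<in> Hom (slice_model C X) (Prod L D P) (\<tau> \<cdot> P)"
    and "pair (slice_model C X) L (Pr1 L D P) h \<in> Weq (slice_model C X)"
proof -
  let ?S = "slice_model C X" and ?Q = "\<tau> \<cdot> P"
  interpret S: category ?S by (rule slice_model_category) unfold_locales
  have P': "P \<in> Hom C (Dom C P) X" using P by (simp add: Obj_slice_model Hom_def)
  have Q: "?Q \<in> Obj ?S"
    using Hom_D[OF Comp_Hom[OF P' \<tau>(1)]] by (simp add: Obj_slice_model)
  have \<tau>Q: "\<tau> \<cdot> ?Q = P"
    using Comp_assoc[OF P' \<tau>(1) \<tau>(1)] \<tau>(2) Ide_Comp[OF P'] by simp
  note p = S.Pr_Hom[OF L D P] and p' = S.Pr_Hom[OF L D Q]
  show h_Hom: "h \<in> Hom ?S (Prod L D P) ?Q"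
    unfolding h by (rule reindex_over_involution[OF \<tau>(1,3) D P p])
  \<comment> \<open>The counterpart of \<open>h\<close> with the roles of \<open>P\<close> and
    \<open>\<tau> \<cdot> P\<close> exchanged; it provides the second component of the inverse
    \<open>?g\<close>.\<close>
  define h' where "h' = (Prod L D ?Q, underlying (Pr2 L D ?Q), P)"
  have h'_Hom: "h' \<in> Hom ?S (Prod L D ?Q) P"
    using reindex_over_involution[OF \<tau>(1,3) D Q p'] by (simp add: h'_def \<tau>Q)
  let ?f = "pair ?S L (Pr1 L D P) h" and ?g = "pair ?S L (Pr1 L D ?Q) h'"
  note f = S.pair_Hom[OF L p(1) h_Hom] and g = S.pair_Hom[OF L p'(1) h'_Hom]
  have Pr2: "Pr2 L D P = (Prod L D P, underlying (Pr2 L D P), P)"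
    "Pr2 L D ?Q = (Prod L D ?Q, underlying (Pr2 L D ?Q), ?Q)"
    using p(2) p'(2) by (auto simp: Hom_slice_model underlying_def)
  have fE: "\<exists>k. ?f = (Prod L D P, k, Prod L D ?Q)" and gE: "\<exists>k. ?g = (Prod L D ?Q, k, Prod L D P)"
    using f(1) g(1) by (auto simp: Hom_slice_model)
  \<comment> \<open>As \<open>h'\<close> has the underlying arrow of \<open>Pr2 L D ?Q\<close>, and
    \<open>h\<close> that of \<open>Pr2 L D P\<close>, this is the projection law of the pair
    \<open>?f\<close> with another target.\<close>
  have h'f: "h' \<cdot>\<^bsub>?S\<^esub> ?f = Pr2 L D P"
  proof -
    obtain k where k: "?f = (Prod L D P, k, Prod L D ?Q)" using fE by blast
    have "Pr2 L D ?Q \<cdot>\<^bsub>?S\<^esub> ?f = h" by (rule f(3))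
    then have "underlying (Pr2 L D ?Q) \<cdot> k = underlying (Pr2 L D P)"
      by (subst (asm) Pr2(2), simp only: k) (simp add: h slice_model_simps)
    then show ?thesis by (subst Pr2(1)) (simp add: k h'_def slice_model_simps)
  qed
  have hg: "h \<cdot>\<^bsub>?S\<^esub> ?g = Pr2 L D ?Q"
  proof -
    obtain k where k: "?g = (Prod L D ?Q, k, Prod L D P)" using gE by blast
    have "Pr2 L D P \<cdot>\<^bsub>?S\<^esub> ?g = h'" by (rule g(3))
    then have "underlying (Pr2 L D P) \<cdot> k = underlying (Pr2 L D ?Q)"
      by (subst (asm) Pr2(1), simp only: k) (simp add: h'_def slice_model_simps)
    then show ?thesis by (subst Pr2(2)) (simp add: k h slice_model_simps)
  qed
  \<comment> \<open>Compared on projections: both pairs preserve the projection to \<open>D\<close>,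
    and \<open>h'f\<close> settles the other one.\<close>
  have gf: "?g \<cdot>\<^bsub>?S\<^esub> ?f = Ide ?S (Prod L D P)"
    by (rule S.product_ext[OF L D P S.Comp_Hom[OF f(1) g(1)] S.Ide_Hom[OF S.Hom_Obj(1)[OF p(1)]]])
      (simp_all add: S.Comp_assoc[OF f(1) g(1) p(1), symmetric]
        S.Comp_assoc[OF f(1) g(1) p(2), symmetric] f g h'f S.Comp_Ide[OF p(1)] S.Comp_Ide[OF p(2)])
  have fg: "?f \<cdot>\<^bsub>?S\<^esub> ?g = Ide ?S (Prod L D ?Q)"
    by (rule S.product_ext[OF L D Q S.Comp_Hom[OF g(1) f(1)] S.Ide_Hom[OF S.Hom_Obj(1)[OF p'(1)]]])
      (simp_all add: S.Comp_assoc[OF g(1) f(1) p'(1), symmetric]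
        S.Comp_assoc[OF g(1) f(1) p'(2), symmetric] f g hg S.Comp_Ide[OF p'(1)] S.Comp_Ide[OF p'(2)])
  show "?f \<in> Weq ?S" by (rule iso_slice_model_Weq[OF f(1) g(1) gf fg])
qed

end

theorem mainTheorem4:
  fixes C :: "('o, 'a) model_cat"
    and K :: "('o, 'a) products"
    and E B :: 'o
    and q :: 'a
    and S :: "('a, 'a \<times> 'a \<times> 'a) model_cat"
    and L :: "('a, 'a \<times> 'a \<times> 'a) products"
    and D P Q V W :: 'a
    and ev \<iota> mbar :: "'a \<times> 'a \<times> 'a"
    and \<phi> :: "'a \<Rightarrow> 'a \<times> 'a \<times> 'a \<Rightarrow> 'a \<times> 'a \<times> 'a"
  assumes "model_category C"
    and "locally_cartesian_closed C"
    and "binary_products C K"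
    and "q \<in> Hom C E B"
    and "q \<in> Fib C"
    and S: "S = slice_model C (Prod K B B)"
    and "binary_products S L"
    and D: "D = diag C K B"
    and P: "P = E_times_B C K E B q"
    and Q: "Q = B_times_E C K E B q"
    and "is_exponential S L P Q V ev"
    and "is_subfunctor S (Hom_prod_weq S L P Q) (Hom_prod S L P Q)"
    and "represents S (Hom_prod_weq S L P Q) W \<phi>"
    and mbar: "mbar = exp_transpose S L P V ev D (diag_proj C K L E B q)"
    and \<iota>: "\<iota> = induced_by_inclusion S W \<phi> V (\<lambda>Z. exp_untranspose S L P ev)"
  shows "\<exists>!m. m \<in> Hom S D W \<and> mbar = \<iota> \<cdot>\<^bsub>S\<^esub> m"
proof -
  interpret model_category C by fact
  interpret S: category S unfolding S by (rule slice_model_category) unfold_locales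
  note K = \<open>binary_products C K\<close> and q = \<open>q \<in> Hom C E B\<close>
    and L = \<open>binary_products S L\<close>[unfolded S]
  note B = Hom_Obj(2)[OF q] and EB = Pr_Hom[OF K Hom_Obj[OF q]]
  note \<tau> = swap_Hom(1-3)[OF K B]
  have D_Obj: "D \<in> Obj S"
    using Hom_D[OF diag_Hom[OF K B]] by (simp add: D S Obj_slice_model)
  have "P \<in> Hom C (Prod K E B) (Prod K B B)"
    unfolding P E_times_B_def by (rule pair_Hom[OF K Comp_Hom[OF EB(1) q] EB(2)])
  then have P_Obj: "P \<in> Obj S" by (simp add: S Obj_slice_model Hom_def)
  have Q': "Q = swap C K B \<cdot>\<^bsub>C\<^esub> P" by (simp add: Q P B_times_E_def)
  have h: "diag_proj C K L E B q = (Prod L D P, underlying (Pr2 L D P), swap C K B \<cdot>\<^bsub>C\<^esub> P)"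
    by (simp add: diag_proj_def D P B_times_E_def)
  \<comment> \<open>The case of the swap on \<open>B \<times> B\<close>, which fixes the diagonal:
    the lemma yields both that the arrow lies over \<open>B \<times> B\<close> and the weak
    equivalence condition.\<close>
  have "diag_proj C K L E B q \<in> Sec (Hom_prod_weq S L P Q) D"
    using diag_reindex_Weq[OF \<tau>[folded D] D_Obj[unfolded S] P_Obj[unfolded S] L h]
    by (simp add: Hom_prod_weq_def S Q')
  then show ?thesis
    unfolding mbar
    using S.exp_transpose_factors_uniquely[OF \<open>binary_products S L\<close> P_Obj
        \<open>is_exponential S L P Q V ev\<close>
        \<open>is_subfunctor S (Hom_prod_weq S L P Q) (Hom_prod S L P Q)\<close>
        \<open>represents S (Hom_prod_weq S L P Q) W \<phi>\<close> D_Obj _ \<iota>]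
    by blast
qed

end
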